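(* Let $0<\alpha\le 1$ and let $f,g:[a,b]\to\mathbb{R}$ be two functions such that $fg$ is differentiable. Then $$\int_a^b f(x)\,(T_\alpha^a g)(x)\,d\alpha(x,a)=f(x)g(x)\Big|_a^b-\int_a^b g(x)\,(T_\alpha^a f)(x)\,d\alpha(x,a).$$
   Context: For $0<\alpha\le1$, the (left) conformable fractional derivative of order $\alpha$ starting from $a$ of a real-valued function $f$ is $$(T_\alpha^a f)(t)=\lim_{\epsilon\to0}\frac{f(t+\epsilon (t-a)^{1-\alpha})-f(t)}{\epsilon}.$$ The notation $d\alpha(x,a)$ means $(x-a)^{\alpha-1}dx$, and $F(x)|_a^b=F(b)-F(a)$.
   Formalization: Differentiability of fg alone does not make the formula meaningful, so it is also assumed that the conformable derivatives of f and g exist almost everywhere on (a,b) and that at least one of the two integrals exists (Henstock–Kurzweil sense); existence of the other is proved. *)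

theory Defs
  imports "HOL-Analysis.Analysis"
begin

text \<open>
  The left conformable derivative of order \<open>\<alpha>\<close> starting from \<open>a\<close>. It is meant for \<open>t > a\<close>;
  at \<open>t = a\<close> the quotient is degenerate, because \<open>0 powr x = 0\<close> for every \<open>x\<close>, including
  \<open>x = 0\<close>. As with \<open>Lim\<close> in general, the value is unspecified where the limit does not exist.
\<close>

definition conformable_quotient :: "real \<Rightarrow> real \<Rightarrow> (real \<Rightarrow> real) \<Rightarrow> real \<Rightarrow> real \<Rightarrow> real" where
  "conformable_quotient \<alpha> a f t \<epsilon> = (f (t + \<epsilon> * (t - a) powr (1 - \<alpha>)) - f t) / \<epsilon>"

definition conformable_differentiable :: "real \<Rightarrow> real \<Rightarrow> (real \<Rightarrow> real) \<Rightarrow> real \<Rightarrow> bool" where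
  "conformable_differentiable \<alpha> a f t \<longleftrightarrow>
     (\<exists>D. (conformable_quotient \<alpha> a f t \<longlongrightarrow> D) (at 0))"

definition conformable_deriv :: "real \<Rightarrow> real \<Rightarrow> (real \<Rightarrow> real) \<Rightarrow> real \<Rightarrow> real" where
  "conformable_deriv \<alpha> a f t = Lim (at 0) (conformable_quotient \<alpha> a f t)"

text \<open>
  Integration over \<open>S\<close> against \<open>d\<alpha>(x,a) = (x - a)\<^sup>\<alpha>\<^sup>-\<^sup>1 dx\<close>. The Henstock--Kurzweil integral
  covers proper and improper Riemann integrals as well as Lebesgue integrals; the singularity
  of the weight at \<open>x = a\<close> therefore needs no separate limit.
\<close>

definition conformable_integrable_on :: "real \<Rightarrow> real \<Rightarrow> (real \<Rightarrow> real) \<Rightarrow> real set \<Rightarrow> bool" where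
  "conformable_integrable_on \<alpha> a h S \<longleftrightarrow> (\<lambda>x. h x * (x - a) powr (\<alpha> - 1)) integrable_on S"

definition conformable_integral :: "real \<Rightarrow> real \<Rightarrow> real set \<Rightarrow> (real \<Rightarrow> real) \<Rightarrow> real" where
  "conformable_integral \<alpha> a S h = integral S (\<lambda>x. h x * (x - a) powr (\<alpha> - 1))"

end

theory Submission imports Defs begin

text \<open>
  For \<open>x > a\<close> the substitution \<open>h = \<epsilon> (x - a)\<^sup>1\<^sup>-\<^sup>\<alpha>\<close> shows that conformable differentiability is
  ordinary differentiability and that the weight of \<open>d\<alpha>(x,a)\<close> turns the conformable derivative
  into \<open>f'\<close>. The two integrands therefore add up to \<open>(f g)'\<close> almost everywhere. As \<open>f g\<close> is
  differentiable everywhere, \<open>(f g)'\<close> is Henstock--Kurzweil integrable with integral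
  \<open>f b g b - f a g a\<close>, so each integrand is integrable as soon as the other one is.
\<close>

lemma DERIV_of_scaled_quotient:
  fixes f :: "real \<Rightarrow> real"
  assumes "c \<noteq> 0" and lim: "((\<lambda>\<epsilon>. (f (t + \<epsilon> * c) - f t) / \<epsilon>) \<longlongrightarrow> D) (at 0)"
  shows "(f has_real_derivative D / c) (at t)"
proof -
  \<comment> \<open>At \<open>\<epsilon> = h / c\<close> the given quotient is \<open>c\<close>
    times the ordinary difference quotient with increment \<open>h\<close>, hence the division by
    the constant \<open>c\<close>.\<close>
  have "filterlim (\<lambda>h. h / c) (at 0) (at 0)"
    using \<open>c \<noteq> 0\<close> by (auto simp: filterlim_at eventually_at_filter intro!: tendsto_eq_intros)
  from tendsto_divide[OF filterlim_compose[OF lim this] tendsto_const \<open>c \<noteq> 0\<close>]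
  show ?thesis
    using \<open>c \<noteq> 0\<close> unfolding DERIV_def by simp
qed

lemma DERIV_of_conformable_differentiable:
  assumes "conformable_differentiable \<alpha> a f x" and "a < x"
  shows "(f has_real_derivative conformable_deriv \<alpha> a f x * (x - a) powr (\<alpha> - 1)) (at x)"
proof -
  from assms(1) obtain D where D: "(conformable_quotient \<alpha> a f x \<longlongrightarrow> D) (at 0)"
    unfolding conformable_differentiable_def by blast
  then have "conformable_deriv \<alpha> a f x = D"
    unfolding conformable_deriv_def by (intro tendsto_Lim) auto
  moreover have "(f has_real_derivative D / (x - a) powr (1 - \<alpha>)) (at x)"
    using D \<open>a < x\<close>
    by (intro DERIV_of_scaled_quotient) (auto simp: conformable_quotient_def[abs_def])
  moreover have "(x - a) powr (\<alpha> - 1) = 1 / (x - a) powr (1 - \<alpha>)"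
    using powr_minus_divide[of "x - a" "1 - \<alpha>"] by simp
  ultimately show ?thesis by simp
qed

text \<open>\<open>conformable_deriv\<close> is meaningful only where its limit exists, hence the
  almost-everywhere assumption. Since \<open>integral\<close> defaults to 0 on non-integrable
  functions, the conclusion also asserts integrability.\<close>

theorem theorem3p1:
  fixes \<alpha> a b :: real and f g :: "real \<Rightarrow> real"
  assumes "0 < \<alpha>" and "\<alpha> \<le> 1" and "a \<le> b"
    and "(\<lambda>x. f x * g x) differentiable_on {a..b}"
    and "AE x in lebesgue. x \<in> {a<..<b} \<longrightarrow>
           conformable_differentiable \<alpha> a f x \<and> conformable_differentiable \<alpha> a g x"
    and "conformable_integrable_on \<alpha> a (\<lambda>x. f x * conformable_deriv \<alpha> a g x) {a..b} \<or>
         conformable_integrable_on \<alpha> a (\<lambda>x. g x * conformable_deriv \<alpha> a f x) {a..b}"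
  shows "conformable_integrable_on \<alpha> a (\<lambda>x. f x * conformable_deriv \<alpha> a g x) {a..b} \<and>
         conformable_integrable_on \<alpha> a (\<lambda>x. g x * conformable_deriv \<alpha> a f x) {a..b} \<and>
         conformable_integral \<alpha> a {a..b} (\<lambda>x. f x * conformable_deriv \<alpha> a g x) =
           (f b * g b - f a * g a) -
           conformable_integral \<alpha> a {a..b} (\<lambda>x. g x * conformable_deriv \<alpha> a f x)"
proof -
  define u where "u = (\<lambda>x. f x * conformable_deriv \<alpha> a g x * (x - a) powr (\<alpha> - 1))"
  define v where "v = (\<lambda>x. g x * conformable_deriv \<alpha> a f x * (x - a) powr (\<alpha> - 1))"
  let ?I = "f b * g b - f a * g a"
  obtain F' where F': "((\<lambda>x. f x * g x) has_vector_derivative F' x) (at x within {a..b})"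
    if "x \<in> {a..b}" for x
    using assms(4) unfolding differentiable_on_def real_differentiable_def
      has_real_derivative_iff_has_vector_derivative by metis
  obtain N where N: "negligible N"
    and diff: "\<And>x. x \<in> {a<..<b} \<Longrightarrow> x \<notin> N \<Longrightarrow>
      conformable_differentiable \<alpha> a f x \<and> conformable_differentiable \<alpha> a g x"
    by (rule AE_E3[OF assms(5)]) (auto simp: negligible_iff_null_sets intro: that)
  \<comment> \<open>The endpoints join the exceptional set: at \<open>a\<close> the quotient is
    degenerate, and at both ends \<open>F'\<close> is only a one-sided derivative.\<close>
  have eq: "u x + v x = F' x" if "x \<in> {a..b} - (N \<union> {a, b})" for x
  proof -
    from that have x: "x \<in> {a<..<b}" "x \<notin> N" by auto
    from x(1) have "((\<lambda>x. f x * g x) has_real_derivative u x + v x) (at x)"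
      using DERIV_mult[OF DERIV_of_conformable_differentiable DERIV_of_conformable_differentiable,
          of \<alpha> a f x \<alpha> a g] diff[OF x]
      by (simp add: u_def v_def algebra_simps)
    moreover have "((\<lambda>x. f x * g x) has_real_derivative F' x) (at x)"
      using F'[of x] x(1) at_within_Icc_at[of a x b]
      by (simp add: has_real_derivative_iff_has_vector_derivative)
    ultimately show ?thesis by (rule DERIV_unique)
  qed
  \<comment> \<open>For the Henstock--Kurzweil integral, a derivative at every point of the interval
    suffices; \<open>F'\<close> may fail to be Lebesgue integrable.\<close>
  have F'_int: "(F' has_integral ?I) {a..b}"
    by (rule fundamental_theorem_of_calculus[OF \<open>a \<le> b\<close> F'])
  have "negligible (N \<union> {a, b})"
    using N by auto
  then have uv: "((\<lambda>x. u x + v x) has_integral ?I) {a..b}"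
    using eq F'_int by (rule has_integral_spike)
  have "u integrable_on {a..b} \<or> v integrable_on {a..b}"
    using assms(6) by (simp add: conformable_integrable_on_def u_def v_def)
  \<comment> \<open>Subtracting whichever of \<open>u\<close>, \<open>v\<close> is known to be
    integrable from \<open>u + v\<close> leaves the other.\<close>
  then have int: "u integrable_on {a..b}" "v integrable_on {a..b}"
    using integrable_diff[OF has_integral_integrable[OF uv], of u]
      integrable_diff[OF has_integral_integrable[OF uv], of v] by auto
  then have "integral {a..b} u + integral {a..b} v = ?I"
    using integral_add[of u "{a..b}" v] integral_unique[OF uv] by simp
  with int show ?thesis
    by (simp add: conformable_integrable_on_def conformable_integral_def u_def v_def)
qed

end
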